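(* Let $\overline{G}$ be a geometric graph with no isolated vertices. Then $\overline{G}$ is $\mathcal{C}_5$-geocolorable if and only if there exists a thickness edge $C_5$-coloring $\epsilon$ of $\overline{G}$ (colors in $\mathbb{Z}_5=\{1,2,3,4,5\}$, understood mod $5$) such that (1) every vertex of $\overline{G}$ belongs to at most two monochromatic subgraphs under $\epsilon$; (2) two distinct monochromatic subgraphs can have a common vertex only if their colors are not consecutive mod $5$ (equivalently, the $i$-subgraph can share vertices only with the $(i+2)$-subgraph and the $(i+3)$-subgraph); (3) each monochromatic subgraph is bipartite, and moreover for each color $i$ there is a bipartition of the $i$-subgraph such that all vertices of the $i$-subgraph that also lie in the $(i+2)$-subgraph (if any) belong to one partite set, and all vertices that also lie in the $(i+3)$-subgraph (if any) belong to the other partite set.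
   Context: A geometric graph $\overline{G}$ is a finite simple graph $G$ together with a straight-line drawing of $G$ in the plane with vertices in general position (no three vertices collinear, no three edges crossing at a single point). A geometric homomorphism $f:\overline{G}\to\overline{H}$ is a map $V(\overline{G})\to V(\overline{H})$ such that whenever $uv$ is an edge of $\overline{G}$, $f(u)f(v)$ is an edge of $\overline{H}$, and whenever edges $xy$ and $uv$ cross in $\overline{G}$, the edges $f(x)f(y)$ and $f(u)f(v)$ cross in $\overline{H}$; we write $\overline{G}\to\overline{H}$ if one exists. A geometric isomorphism is a bijection such that these two implications are biconditionals. For an abstract graph $H$, the homomorphism poset $\mathcal{H}$ is the set of geometric isomorphism classes of geometric realizations of $H$, ordered by $\overline{H}_1\preceq\overline{H}_2$ iff there is a vertex-injective geometric homomorphism $\overline{H}_1\to\overline{H}_2$. A geometric graph $\overline{G}$ is $\mathcal{H}$-geocolorable iff $\overline{G}\to\overline{H}$ for some maximal element $\overline{H}\in\mathcal{H}$; here $\mathcal{C}_5$ is the homomorphism poset of the $5$-cycle $C_5$ (its unique maximal element is the convex realization, the pentagram-like drawing in which every edge crosses exactly two others). The edge-crossing graph $EX(\overline{G})$ is the abstract graph whose vertices are the edges of $\overline{G}$, two being adjacent iff the corresponding edges cross. A thickness edge $C_5$-coloring of $\overline{G}$ is a graph homomorphism $\epsilon: EX(\overline{G})\to C_5$, i.e. an assignment of colors $1,\dots,5$ to the edges of $\overline{G}$ such that any two crossing edges receive colors that are consecutive mod $5$. For a color $i$, the $i$-subgraph (monochromatic subgraph of color $i$) under $\epsilon$ is the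 plane subgraph of $\overline{G}$ formed by all edges of color $i$ and their endpoints. *)

theory Defs
  imports "HOL-Analysis.Analysis" "HOL-Library.Numeral_Type"
begin

record 'a ugraph =
  verts :: "'a set"
  edges :: "'a set set"

definition simple_graph :: "('a, 'x) ugraph_scheme \<Rightarrow> bool" where
  "simple_graph G \<longleftrightarrow> finite (verts G) \<and> (\<forall>e\<in>edges G. e \<subseteq> verts G \<and> card e = 2)"

definition no_isolated_vertices :: "('a, 'x) ugraph_scheme \<Rightarrow> bool" where
  "no_isolated_vertices G \<longleftrightarrow> (\<forall>v\<in>verts G. \<exists>e\<in>edges G. v \<in> e)"

definition graph_hom :: "('a \<Rightarrow> 'b) \<Rightarrow> ('a, 'x) ugraph_scheme \<Rightarrow> ('b, 'y) ugraph_scheme \<Rightarrow> bool" where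
  "graph_hom f G H \<longleftrightarrow>
     f ` verts G \<subseteq> verts H \<and>
     (\<forall>u v. {u, v} \<in> edges G \<longrightarrow> {f u, f v} \<in> edges H)"

definition bipartition :: "('a, 'x) ugraph_scheme \<Rightarrow> 'a set \<Rightarrow> 'a set \<Rightarrow> bool" where
  "bipartition G A B \<longleftrightarrow>
     A \<union> B = verts G \<and> A \<inter> B = {} \<and> (\<forall>e\<in>edges G. \<exists>a\<in>A. \<exists>b\<in>B. e = {a, b})"

definition bipartite :: "('a, 'x) ugraph_scheme \<Rightarrow> bool" where
  "bipartite G \<longleftrightarrow> (\<exists>A B. bipartition G A B)"

text \<open>A straight-line drawing is given by the positions of the vertices; only the values of
  \<open>pos\<close> on \<open>verts\<close> matter.\<close>

record 'a geograph = "'a ugraph" +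
  pos :: "'a \<Rightarrow> real \<times> real"

definition edge_interior :: "'a geograph \<Rightarrow> 'a set \<Rightarrow> (real \<times> real) set" where
  "edge_interior G e = {p. \<exists>u v. e = {u, v} \<and> p \<in> open_segment (pos G u) (pos G v)}"

definition geometric_graph :: "'a geograph \<Rightarrow> bool" where
  "geometric_graph G \<longleftrightarrow>
     simple_graph G \<and>
     inj_on (pos G) (verts G) \<and>
     (\<forall>u\<in>verts G. \<forall>v\<in>verts G. \<forall>w\<in>verts G.
        distinct [u, v, w] \<longrightarrow> \<not> collinear {pos G u, pos G v, pos G w}) \<and>
     (\<forall>e\<in>edges G. \<forall>f\<in>edges G. \<forall>g\<in>edges G.
        distinct [e, f, g] \<longrightarrow> edge_interior G e \<inter> edge_interior G f \<inter> edge_interior G g = {})"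

definition crosses :: "'a geograph \<Rightarrow> 'a set \<Rightarrow> 'a set \<Rightarrow> bool" where
  "crosses G e f \<longleftrightarrow>
     e \<in> edges G \<and> f \<in> edges G \<and> e \<noteq> f \<and> edge_interior G e \<inter> edge_interior G f \<noteq> {}"

definition geo_hom :: "('a \<Rightarrow> 'b) \<Rightarrow> 'a geograph \<Rightarrow> 'b geograph \<Rightarrow> bool" where
  "geo_hom f G H \<longleftrightarrow>
     graph_hom f G H \<and>
     (\<forall>x y u v. crosses G {x, y} {u, v} \<longrightarrow> crosses H {f x, f y} {f u, f v})"

definition geo_iso :: "('a \<Rightarrow> 'b) \<Rightarrow> 'a geograph \<Rightarrow> 'b geograph \<Rightarrow> bool" where
  "geo_iso f G H \<longleftrightarrow>
     bij_betw f (verts G) (verts H) \<and>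
     (\<forall>u\<in>verts G. \<forall>v\<in>verts G. {u, v} \<in> edges G \<longleftrightarrow> {f u, f v} \<in> edges H) \<and>
     (\<forall>x\<in>verts G. \<forall>y\<in>verts G. \<forall>u\<in>verts G. \<forall>v\<in>verts G.
        crosses G {x, y} {u, v} \<longleftrightarrow> crosses H {f x, f y} {f u, f v})"

text \<open>It suffices to draw \<open>H\<close> on its own vertex set: every geometric graph abstractly isomorphic
  to \<open>H\<close> is geometrically isomorphic to such a drawing, by relabelling.\<close>

definition realizations :: "'a ugraph \<Rightarrow> 'a geograph set" where
  "realizations H = {R. geometric_graph R \<and> verts R = verts H \<and> edges R = edges H}"

definition geo_iso_rel :: "'a ugraph \<Rightarrow> 'a geograph rel" where
  "geo_iso_rel H =
     {(R, S). R \<in> realizations H \<and> S \<in> realizations H \<and> (\<exists>f. geo_iso f R S)}"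

definition hom_poset :: "'a ugraph \<Rightarrow> 'a geograph set set" where
  "hom_poset H = realizations H // geo_iso_rel H"

definition hom_le :: "'a geograph set \<Rightarrow> 'a geograph set \<Rightarrow> bool" where
  "hom_le C D \<longleftrightarrow> (\<exists>R\<in>C. \<exists>S\<in>D. \<exists>f. geo_hom f R S \<and> inj_on f (verts R))"

definition maximal_in_hom_poset :: "'a ugraph \<Rightarrow> 'a geograph set \<Rightarrow> bool" where
  "maximal_in_hom_poset H C \<longleftrightarrow>
     C \<in> hom_poset H \<and> (\<forall>D\<in>hom_poset H. hom_le C D \<longrightarrow> D = C)"

definition geocolorable :: "'b ugraph \<Rightarrow> 'a geograph \<Rightarrow> bool" where
  "geocolorable H G \<longleftrightarrow>
     (\<exists>C. maximal_in_hom_poset H C \<and> (\<exists>R\<in>C. \<exists>f. geo_hom f G R))"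

text \<open>The numeral type \<open>5\<close> is the ring of integers modulo 5, so that \<open>5 = 0\<close> there and
  \<open>i + 1\<close>, \<open>i + 2\<close>, \<open>i + 3\<close> are taken modulo 5.\<close>

definition consecutive :: "5 \<Rightarrow> 5 \<Rightarrow> bool" where
  "consecutive i j \<longleftrightarrow> j = i + 1 \<or> i = j + 1"

definition cycle5 :: "5 ugraph" where
  "cycle5 = \<lparr>verts = UNIV, edges = {{i, j} | i j. consecutive i j}\<rparr>"

definition edge_crossing_graph :: "'a geograph \<Rightarrow> 'a set ugraph" where
  "edge_crossing_graph G = \<lparr>verts = edges G, edges = {{e, f} | e f. crosses G e f}\<rparr>"

definition thickness_edge_C5_coloring :: "'a geograph \<Rightarrow> ('a set \<Rightarrow> 5) \<Rightarrow> bool" where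
  "thickness_edge_C5_coloring G \<epsilon> \<longleftrightarrow> graph_hom \<epsilon> (edge_crossing_graph G) cycle5"

definition mono_subgraph :: "'a geograph \<Rightarrow> ('a set \<Rightarrow> 5) \<Rightarrow> 5 \<Rightarrow> 'a ugraph" where
  "mono_subgraph G \<epsilon> i =
     \<lparr>verts = \<Union>{e \<in> edges G. \<epsilon> e = i}, edges = {e \<in> edges G. \<epsilon> e = i}\<rparr>"

end

theory Submission
  imports Defs
begin

text \<open>
  In a geometric graph crossing edges are disjoint, so a realization of \<open>H\<close> in which any two disjoint
  edges cross is the top of the homomorphism poset. For \<open>C\<^sub>5\<close> such a realization exists: put the
  vertices \<open>0, 1, 2, 3, 4\<close> on the parabola \<open>y = x\<^sup>2\<close> at \<open>x = 0, 2, 4, 1, 3\<close>.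
  The edges \<open>{2i, 2i + 1}\<close> and \<open>{2j, 2j + 1}\<close> of \<open>C\<^sub>5\<close> are disjoint exactly if \<open>i\<close> and \<open>j\<close> are
  consecutive, which turns geocolorings \<open>f\<close> into edge colorings: the color \<open>i\<close> stands for the edge
  \<open>{2i, 2i + 1}\<close>, and the fibres of \<open>f\<close> over its ends bipartition the \<open>i\<close>-subgraph. Its end \<open>2i\<close>
  is shared with the color \<open>i + 2\<close> and its end \<open>2i + 1\<close> with the color \<open>i + 3\<close>, so conversely the
  bipartitions of all colors glue to one map \<open>f\<close>.
\<close>

section \<open>Crossings and maximal realizations\<close>

lemma edge_interior_doubleton:
  "edge_interior G {u, v} = open_segment (pos G u) (pos G v)"
  unfolding edge_interior_def by (auto simp: doubleton_eq_iff open_segment_commute)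

text \<open>The point \<open>p\<close> differs from \<open>a\<close> and lies on the line through
  \<open>a\<close> and \<open>b\<close> as well as on that through \<open>a\<close> and
  \<open>c\<close>, so the two lines coincide.\<close>

lemma collinear_if_open_segments_meet:
  fixes a b c :: "'a::euclidean_space"
  assumes "p \<in> open_segment a b" "p \<in> open_segment a c"
  shows "collinear {a, b, c}"
proof -
  have "between (a, b) p" "between (a, c) p" "p \<noteq> a"
    using assms by (auto simp: between_mem_segment open_segment_def)
  then have "collinear {b, a, p}" "collinear {a, p, c}"
    by (auto simp: collinear_between_cases between_commute)
  then have "collinear {b, a, c}"
    using \<open>p \<noteq> a\<close> by (metis collinear_3_trans)
  then show ?thesis
    by (simp add: insert_commute)
qed

text \<open>A common end of \<open>e\<close> and \<open>f\<close> would make three vertices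
  collinear. Stated from simplicity and non-collinearity so that it applies to the pentagram before
  that is known to be a geometric graph.\<close>

lemma disjoint_if_interiors_meet:
  assumes "simple_graph G"
    and "\<forall>u\<in>verts G. \<forall>v\<in>verts G. \<forall>w\<in>verts G.
      distinct [u, v, w] \<longrightarrow> \<not> collinear {pos G u, pos G v, pos G w}"
    and "e \<in> edges G" "f \<in> edges G" "e \<noteq> f"
    and "edge_interior G e \<inter> edge_interior G f \<noteq> {}"
  shows "e \<inter> f = {}"
proof (rule ccontr)
  assume "e \<inter> f \<noteq> {}"
  then obtain a where a: "a \<in> e" "a \<in> f"
    by blast
  have ef: "card e = 2" "card f = 2" "e \<subseteq> verts G" "f \<subseteq> verts G"
    using assms(1,3,4) by (auto simp: simple_graph_def)
  obtain b where b: "e = {a, b}" "b \<noteq> a"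
    using ef(1) a(1) by (auto simp: card_2_iff)
  obtain c where c: "f = {a, c}" "c \<noteq> a"
    using ef(2) a(2) by (auto simp: card_2_iff)
  have "b \<noteq> c"
    using b c assms(5) by blast
  moreover have "collinear {pos G a, pos G b, pos G c}"
    using assms(6) b c collinear_if_open_segments_meet
    by (auto simp: edge_interior_doubleton)
  ultimately show False
    using assms(2) ef(3,4) b c by auto
qed

lemma crosses_disjoint:
  assumes "geometric_graph G" "crosses G e f"
  shows "e \<inter> f = {}"
  using assms disjoint_if_interiors_meet[of G e f]
  by (auto simp: geometric_graph_def crosses_def)

section \<open>Realizations with all possible crossings\<close>

definition fully_crossing :: "'a geograph \<Rightarrow> bool" where
  "fully_crossing R \<longleftrightarrow> (\<forall>e\<in>edges R. \<forall>f\<in>edges R. e \<inter> f = {} \<longrightarrow> crosses R e f)"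

lemma simple_graph_edgeE:
  assumes "simple_graph G" "e \<in> edges G"
  obtains u v where "e = {u, v}" "u \<noteq> v" "u \<in> verts G" "v \<in> verts G"
  using assms by (metis card_2_iff insert_subset simple_graph_def)

lemma realizationsD:
  assumes "R \<in> realizations H"
  shows "geometric_graph R" "simple_graph R" "verts R = verts H" "edges R = edges H"
  using assms by (auto simp: realizations_def geometric_graph_def)

lemma geo_hom_crosses:
  assumes "geo_hom f G H" "simple_graph G" "crosses G e e'"
  shows "crosses H (f ` e) (f ` e')"
proof -
  have "e \<in> edges G" "e' \<in> edges G"
    using assms(3) by (auto simp: crosses_def)
  then obtain x y u v where "e = {x, y}" "e' = {u, v}"
    using assms(2) by (metis simple_graph_edgeE)
  then show ?thesis
    using assms(1,3) by (auto simp: geo_hom_def)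
qed

lemma geo_hom_edge:
  assumes "geo_hom f G H" "simple_graph G" "e \<in> edges G"
  shows "f ` e \<in> edges H"
  using assms by (elim simple_graph_edgeE) (auto simp: geo_hom_def graph_hom_def)

lemma geo_iso_imp_geo_hom:
  assumes "geo_iso f G H" "simple_graph G"
  shows "geo_hom f G H" "inj_on f (verts G)"
proof -
  have E: "u \<in> verts G \<and> v \<in> verts G" if "{u, v} \<in> edges G" for u v
    using that assms(2) by (auto simp: simple_graph_def)
  have C: "{x, y} \<in> edges G \<and> {u, v} \<in> edges G" if "crosses G {x, y} {u, v}" for x y u v
    using that by (auto simp: crosses_def)
  show "geo_hom f G H"
    using assms(1) E C unfolding geo_hom_def graph_hom_def geo_iso_def
    by (metis bij_betw_imp_surj_on order_refl)
  show "inj_on f (verts G)"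
    using assms(1) by (auto simp: geo_iso_def bij_betw_def)
qed

text \<open>The injection \<open>f\<close> permutes the finite edge set, so every pair of disjoint edges of \<open>S\<close> is
  the image of such a pair of \<open>R\<close>.\<close>

lemma fully_crossing_image:
  assumes R: "R \<in> realizations H" and S: "S \<in> realizations H"
    and full: "fully_crossing R"
    and f: "geo_hom f R S" "inj_on f (verts R)"
  shows "fully_crossing S"
proof -
  note R = realizationsD[OF R] and S = realizationsD[OF S]
  have sub: "edges R \<subseteq> Pow (verts R)"
    using R(2) by (auto simp: simple_graph_def)
  have "finite (edges R)"
    using sub R(2) by (meson finite_Pow_iff finite_subset simple_graph_def)
  moreover have "(`) f ` edges R \<subseteq> edges R"
    using geo_hom_edge[OF f(1) R(2)] R(4) S(4) by auto
  moreover have "inj_on ((`) f) (edges R)"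
    using sub inj_on_image_Pow[OF f(2)] inj_on_subset by blast
  ultimately have surj: "(`) f ` edges R = edges S"
    using R(4) S(4) by (simp add: endo_inj_surj)
  show ?thesis
    unfolding fully_crossing_def
  proof (intro ballI impI)
    fix e' g'
    assume "e' \<in> edges S" "g' \<in> edges S" and disj: "e' \<inter> g' = {}"
    then obtain e g where eg: "e \<in> edges R" "g \<in> edges R" "e' = f ` e" "g' = f ` g"
      unfolding surj[symmetric] by blast
    then have "crosses R e g"
      using full disj by (auto simp: fully_crossing_def)
    then show "crosses S e' g'"
      using geo_hom_crosses[OF f(1) R(2)] eg by blast
  qed
qed

text \<open>Both drawings have the same vertices and edges, and edges that cross in \<open>R\<close>
  are disjoint, hence cross in \<open>S\<close>. So a fully crossing realization lies above all
  others.\<close>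

lemma geo_hom_into_fully_crossing:
  assumes R: "R \<in> realizations H" and S: "S \<in> realizations H" and "fully_crossing S"
  shows "geo_hom id R S"
proof -
  note R = realizationsD[OF R] and S = realizationsD[OF S]
  have "crosses S e g" if "crosses R e g" for e g
    using that crosses_disjoint[OF R(1) that] assms(3) R(4) S(4)
    by (auto simp: crosses_def fully_crossing_def)
  then show ?thesis
    using R S by (auto simp: geo_hom_def graph_hom_def)
qed

lemma fully_crossing_geo_iso:
  assumes "R \<in> realizations H" "S \<in> realizations H" "fully_crossing R" "fully_crossing S"
  shows "geo_iso id R S"
  using geo_hom_into_fully_crossing[OF assms(1,2,4)]
    geo_hom_into_fully_crossing[OF assms(2,1,3)] realizationsD[OF assms(1)]
    realizationsD[OF assms(2)]
  by (auto simp: geo_iso_def geo_hom_def)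

text \<open>Makes full crossing a property of isomorphism classes. Backwards, injectivity keeps
  disjoint edges disjoint, and the biconditional pulls the crossing of their images back to
  \<open>R\<close>.\<close>

lemma fully_crossing_geo_iso_iff:
  assumes R: "R \<in> realizations H" and S: "S \<in> realizations H" and f: "geo_iso f R S"
  shows "fully_crossing R \<longleftrightarrow> fully_crossing S"
proof
  note R' = realizationsD[OF R]
  note hom = geo_iso_imp_geo_hom[OF f R'(2)]
  show "fully_crossing R \<Longrightarrow> fully_crossing S"
    using fully_crossing_image[OF R S _ hom] .
  assume full: "fully_crossing S"
  show "fully_crossing R"
    unfolding fully_crossing_def
  proof (intro ballI impI)
    fix e g
    assume eg: "e \<in> edges R" "g \<in> edges R" and disj: "e \<inter> g = {}"
    obtain x y where e: "e = {x, y}" "x \<in> verts R" "y \<in> verts R"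
      using simple_graph_edgeE[OF R'(2) eg(1)] by metis
    obtain u v where g: "g = {u, v}" "u \<in> verts R" "v \<in> verts R"
      using simple_graph_edgeE[OF R'(2) eg(2)] by metis
    have "f ` e \<inter> f ` g = {}"
      using disj e g inj_on_image_Int[OF hom(2), of e g] by auto
    then have "crosses S (f ` e) (f ` g)"
      using full geo_hom_edge[OF hom(1) R'(2)] eg by (auto simp: fully_crossing_def)
    then show "crosses R e g"
      using f e g by (auto simp: geo_iso_def)
  qed
qed

text \<open>The identity is an isomorphism between any two fully crossing realizations, so they fill
  a single class, which can be described without a representative.\<close>

lemma geo_iso_class_fully_crossing:
  assumes "R \<in> realizations H" "fully_crossing R"
  shows "geo_iso_rel H `` {R} = {S \<in> realizations H. fully_crossing S}"
  using assms fully_crossing_geo_iso fully_crossing_geo_iso_iff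
  by (fastforce simp: geo_iso_rel_def)

text \<open>Injective homomorphisms between realizations preserve full crossing, so a class above
  this one again consists of fully crossing realizations.\<close>

lemma maximal_fully_crossing:
  assumes P: "P \<in> realizations H" "fully_crossing P"
  shows "maximal_in_hom_poset H {S \<in> realizations H. fully_crossing S}"
    (is "maximal_in_hom_poset H ?C")
  unfolding maximal_in_hom_poset_def
proof (intro conjI ballI impI)
  show "?C \<in> hom_poset H"
    using P geo_iso_class_fully_crossing[OF P] by (auto simp: hom_poset_def quotient_def)
  fix D
  assume D: "D \<in> hom_poset H" and le: "hom_le ?C D"
  obtain T where T: "T \<in> realizations H" "D = geo_iso_rel H `` {T}"
    using D by (auto simp: hom_poset_def quotient_def)
  obtain R S f where R: "R \<in> ?C" and S: "S \<in> D"
    and f: "geo_hom f R S" "inj_on f (verts R)"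
    using le unfolding hom_le_def by blast
  \<comment> \<open>\<open>hom_le\<close> yields some representative \<open>S\<close> of
    \<open>D\<close>, not \<open>T\<close> itself; the isomorphism \<open>g\<close> carries full
    crossing from \<open>S\<close> back to \<open>T\<close>.\<close>
  obtain g where S': "S \<in> realizations H" and g: "geo_iso g T S"
    using S T by (auto simp: geo_iso_rel_def)
  have "fully_crossing S"
    using fully_crossing_image[of R H S f] R S' f by blast
  then have "fully_crossing T"
    using fully_crossing_geo_iso_iff[OF T(1) S' g] by blast
  then show "D = ?C"
    using T geo_iso_class_fully_crossing by blast
qed

lemma geo_hom_trans:
  assumes "geo_hom f G H" "geo_hom g H K"
  shows "geo_hom (g \<circ> f) G K"
  using assms by (fastforce simp: geo_hom_def graph_hom_def)

text \<open>One target \<open>P\<close> replaces the choice of a maximal class: a homomorphism into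
  any realization of \<open>H\<close>, followed by the identity, is one into
  \<open>P\<close>.\<close>

lemma geocolorable_iff_geo_hom:
  assumes P: "P \<in> realizations H" "fully_crossing P"
  shows "geocolorable H G \<longleftrightarrow> (\<exists>f. geo_hom f G P)"
proof
  assume "geocolorable H G"
  then obtain C R f where C: "C \<in> hom_poset H" "R \<in> C" and f: "geo_hom f G R"
    by (auto simp: geocolorable_def maximal_in_hom_poset_def)
  have "R \<in> realizations H"
    using C by (auto simp: hom_poset_def quotient_def geo_iso_rel_def)
  then show "\<exists>f. geo_hom f G P"
    using geo_hom_trans[OF f] geo_hom_into_fully_crossing P by blast
next
  assume "\<exists>f. geo_hom f G P"
  then show "geocolorable H G"
    using maximal_fully_crossing[OF P] P unfolding geocolorable_def by blast
qed

section \<open>The pentagram\<close>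

lemma mod5_exhaust: "(i::5) = 0 \<or> i = 1 \<or> i = 2 \<or> i = 3 \<or> i = 4"
proof -
  obtain z where i: "i = of_int z" and "0 \<le> z" "z < 5"
    by (cases i rule: bit1_cases) simp
  then have "z = 0 \<or> z = 1 \<or> z = 2 \<or> z = 3 \<or> z = 4"
    by arith
  then show ?thesis
    using i by auto
qed

lemma five_mod5: "(5::5) = 0"
  by simp

text \<open>Reduces claims about vertices or colors of the 5-cycle to numeral instances that
  simplification decides.\<close>

lemma all_mod5: "(\<forall>i::5. P i) \<longleftrightarrow> P 0 \<and> P 1 \<and> P 2 \<and> P 3 \<and> P 4"
  using mod5_exhaust by metis

text \<open>Strict convexity of the square: for \<open>b = u * a + (1 - u) * c\<close>, the chord
  lies above the parabola at \<open>b\<close> by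
  \<open>u * (1 - u) * (a - c)\<^sup>2\<close>.\<close>

lemma not_collinear_parabola:
  fixes a b c :: real
  assumes "a \<noteq> b" "a \<noteq> c" "b \<noteq> c"
  shows "\<not> collinear {(a, a\<^sup>2), (b, b\<^sup>2), (c, c\<^sup>2)}"
proof
  assume "collinear {(a, a\<^sup>2), (b, b\<^sup>2), (c, c\<^sup>2)}"
  then obtain u where b: "b = u * a + (1 - u) * c" and b2: "b\<^sup>2 = u * a\<^sup>2 + (1 - u) * c\<^sup>2"
    using assms by (auto simp: collinear_3_expand)
  have "u * (1 - u) * (a - c)\<^sup>2 = 0"
    using b2 unfolding b by (simp add: power2_eq_square algebra_simps)
  then have "u = 0 \<or> u = 1"
    using assms by auto
  then show False
    using b assms by auto
qed

text \<open>The chord over \<open>p\<close> and \<open>q\<close> lies on the line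
  \<open>y = (p + q) * x - p * q\<close>. Equating two such lines gives the abscissa
  \<open>x\<close> below, which lies inside both chords because their ends interleave.\<close>

lemma parabola_chords_cross:
  fixes a b c d :: real
  assumes "a < c" "c < b" "b < d"
  shows "open_segment (a, a\<^sup>2) (b, b\<^sup>2) \<inter> open_segment (c, c\<^sup>2) (d, d\<^sup>2) \<noteq> {}"
proof -
  define s where "s = (c + d) - (a + b)"
  define x where "x = (c * d - a * b) / s"
  have s: "s > 0"
    using assms by (simp add: s_def)
  have on_chord: "(x, (p + q) * x - p * q) \<in> open_segment (p, p\<^sup>2) (q, q\<^sup>2)"
    if "p < x" "x < q" for p q
  proof -
    have "q - p > 0"
      using that by simp
    define u where "u = (x - p) / (q - p)"
    have x: "x = p + u * (q - p)"
      using \<open>q - p > 0\<close> by (simp add: u_def)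
    have "0 < u" "u < 1"
      using that by (auto simp: u_def field_simps)
    moreover have "x = (1 - u) * p + u * q"
      by (simp add: x algebra_simps)
    moreover have "(p + q) * x - p * q = (1 - u) * p\<^sup>2 + u * q\<^sup>2"
      by (simp add: x algebra_simps power2_eq_square)
    ultimately show ?thesis
      using that by (auto simp: in_segment)
  qed
  have xs: "x * s = c * d - a * b"
    using s by (simp add: x_def)
  \<comment> \<open>These factorizations turn the order of \<open>a\<close>, \<open>c\<close>,
    \<open>b\<close>, \<open>d\<close> into the position of \<open>x\<close>.\<close>
  have "(x - a) * s = (c - a) * (d - a)" "(b - x) * s = (b - c) * (d - b)"
    "(x - c) * s = (c - a) * (b - c)" "(d - x) * s = (d - a) * (d - b)"
    using xs unfolding s_def by algebra+
  then have "(x - a) * s > 0" "(b - x) * s > 0" "(x - c) * s > 0" "(d - x) * s > 0"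
    using assms by simp_all
  then have "a < x" "x < b" "c < x" "x < d"
    using s by (simp_all add: zero_less_mult_iff)
  moreover have "(a + b) * x - a * b = (c + d) * x - c * d"
    using xs unfolding s_def by algebra
  ultimately show ?thesis
    using on_chord[of a b] on_chord[of c d] by auto
qed

section \<open>The pentagram drawing of the 5-cycle\<close>

definition star_abscissa :: "5 \<Rightarrow> real" where
  "star_abscissa k =
    (if k = 0 then 0 else if k = 1 then 2 else if k = 2 then 4 else if k = 3 then 1 else 3)"

text \<open>The abscissa of \<open>k\<close> is \<open>2 * k\<close> reduced modulo 5, so edges of
  the cycle join points two apart in convex position: they are the five diagonals of a convex
  pentagon.\<close>

definition pentagram :: "5 geograph" where
  "pentagram = \<lparr>verts = UNIV, edges = edges cycle5,
     pos = (\<lambda>k. (star_abscissa k, (star_abscissa k)\<^sup>2))\<rparr>"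

lemma star_abscissa_eq_iff: "star_abscissa i = star_abscissa j \<longleftrightarrow> i = j"
proof -
  have "\<forall>i j. star_abscissa i = star_abscissa j \<longleftrightarrow> i = j"
    by (simp add: all_mod5 star_abscissa_def)
  then show ?thesis
    by blast
qed

lemma edges_cycle5: "e \<in> edges cycle5 \<longleftrightarrow> (\<exists>k. e = {k, k + 1})"
  by (auto simp: cycle5_def consecutive_def)

lemma edges_cycle5_color: "e \<in> edges cycle5 \<longleftrightarrow> (\<exists>i. e = {2 * i, 2 * i + 1})"
proof -
  \<comment> \<open>\<open>3\<close> is the inverse of \<open>2\<close> modulo 5, so every edge has
    the form \<open>{2 * i, 2 * i + 1}\<close>.\<close>
  have "k = 2 * (3 * k)" for k :: 5
    by (simp add: five_mod5)
  then show ?thesis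
    unfolding edges_cycle5 by metis
qed

lemma simple_graph_cycle5: "simple_graph cycle5"
  by (auto simp: simple_graph_def edges_cycle5) (auto simp: cycle5_def)

lemma cycle5_no_three_disjoint_edges:
  assumes "e \<in> edges cycle5" "f \<in> edges cycle5" "g \<in> edges cycle5"
  shows "e \<inter> f \<noteq> {} \<or> e \<inter> g \<noteq> {} \<or> f \<inter> g \<noteq> {}"
proof -
  obtain i j k where ijk: "e = {i, i + 1}" "f = {j, j + 1}" "g = {k, k + 1}"
    using assms unfolding edges_cycle5 by blast
  have "\<forall>i j :: 5. {i, i + 1} \<inter> {j, j + 1} = {} \<longrightarrow> j = i + 2 \<or> j = i + 3"
    by (simp add: all_mod5)
  then have "(j = i + 2 \<or> j = i + 3) \<and> (k = i + 2 \<or> k = i + 3) \<and> (k = j + 2 \<or> k = j + 3)"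
    if "\<not> ?thesis"
    using that unfolding ijk by blast
  then show ?thesis
    \<comment> \<open>\<open>k - j\<close> is a difference of two elements of \<open>{2, 3}\<close>,
      hence 0, 1 or -1 modulo 5, which is neither 2 nor 3.\<close>
    by (auto simp: add.assoc)
qed

text \<open>Three concurrent edges would be pairwise disjoint by non-collinearity, and the 5-cycle
  has no three such edges.\<close>

lemma geometric_graph_pentagram: "geometric_graph pentagram"
proof -
  have simple: "simple_graph pentagram"
    using simple_graph_cycle5 by (simp add: simple_graph_def pentagram_def cycle5_def)
  have noncoll: "\<forall>u\<in>verts pentagram. \<forall>v\<in>verts pentagram. \<forall>w\<in>verts pentagram.
      distinct [u, v, w] \<longrightarrow> \<not> collinear {pos pentagram u, pos pentagram v, pos pentagram w}"
    by (simp add: pentagram_def not_collinear_parabola star_abscissa_eq_iff)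
  have adjacent: "edge_interior pentagram e \<inter> edge_interior pentagram f = {}"
    if "e \<in> edges pentagram" "f \<in> edges pentagram" "e \<noteq> f" "e \<inter> f \<noteq> {}" for e f
    using disjoint_if_interiors_meet[OF simple noncoll that(1-3)] that(4) by blast
  have "edge_interior pentagram e \<inter> edge_interior pentagram f \<inter> edge_interior pentagram g = {}"
    if "e \<in> edges pentagram" "f \<in> edges pentagram" "g \<in> edges pentagram" "distinct [e, f, g]"
    for e f g
  proof -
    have "e \<inter> f \<noteq> {} \<or> e \<inter> g \<noteq> {} \<or> f \<inter> g \<noteq> {}"
      using that(1-3) by (intro cycle5_no_three_disjoint_edges) (simp_all add: pentagram_def)
    then show ?thesis
    proof (elim disjE)
      assume "e \<inter> f \<noteq> {}"
      then show ?thesis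
        using adjacent[of e f] that by simp
    next
      assume "e \<inter> g \<noteq> {}"
      then have "edge_interior pentagram e \<inter> edge_interior pentagram g = {}"
        using adjacent[of e g] that by simp
      then show ?thesis
        by blast
    next
      assume "f \<inter> g \<noteq> {}"
      then have "edge_interior pentagram f \<inter> edge_interior pentagram g = {}"
        using adjacent[of f g] that by simp
      then show ?thesis
        by blast
    qed
  qed
  moreover have "inj_on (pos pentagram) (verts pentagram)"
    by (simp add: inj_on_def pentagram_def star_abscissa_eq_iff)
  ultimately show ?thesis
    using simple noncoll unfolding geometric_graph_def by blast
qed

lemma pentagram_realization: "pentagram \<in> realizations cycle5"
  using geometric_graph_pentagram by (simp add: realizations_def pentagram_def cycle5_def)

lemma fully_crossing_pentagram: "fully_crossing pentagram"
  unfolding fully_crossing_def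
proof (intro ballI impI)
  fix e f
  assume e: "e \<in> edges pentagram" and f: "f \<in> edges pentagram" and disj: "e \<inter> f = {}"
  let ?S = "\<lambda>i j. open_segment (star_abscissa i, (star_abscissa i)\<^sup>2)
                      (star_abscissa j, (star_abscissa j)\<^sup>2)"
  have ab: "star_abscissa 0 = 0" "star_abscissa 1 = 2" "star_abscissa 2 = 4"
    "star_abscissa 3 = 1" "star_abscissa 4 = 3"
    by (simp_all add: star_abscissa_def)
  \<comment> \<open>The five unordered pairs of disjoint edges, each written so that the abscissae
    of the ends interleave as \<open>parabola_chords_cross\<close> demands.\<close>
  have "?S 0 1 \<inter> ?S 3 4 \<noteq> {}" "?S 3 4 \<inter> ?S 1 2 \<noteq> {}" "?S 0 4 \<inter> ?S 3 2 \<noteq> {}"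
    "?S 0 4 \<inter> ?S 1 2 \<noteq> {}" "?S 0 1 \<inter> ?S 3 2 \<noteq> {}"
    unfolding ab by (rule parabola_chords_cross; simp)+
  then have meet: "\<forall>i j. {i, i + 1} \<inter> {j, j + 1} = {} \<longrightarrow> ?S i (i + 1) \<inter> ?S j (j + 1) \<noteq> {}"
    by (simp add: all_mod5 five_mod5 Int_commute open_segment_commute)
  obtain i j where ij: "e = {i, i + 1}" "f = {j, j + 1}"
    using e f edges_cycle5 by (auto simp: pentagram_def)
  have "edge_interior pentagram e \<inter> edge_interior pentagram f \<noteq> {}"
    using meet disj unfolding ij edge_interior_doubleton by (simp add: pentagram_def)
  then show "crosses pentagram e f"
    using e f disj ij by (auto simp: crosses_def)
qed

lemma geocolorable_cycle5_iff: "geocolorable cycle5 G \<longleftrightarrow> (\<exists>f. geo_hom f G pentagram)"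
  by (rule geocolorable_iff_geo_hom[OF pentagram_realization fully_crossing_pentagram])

text \<open>In the pentagram crossing amounts to disjointness. Its edge-crossing graph is therefore
  again a 5-cycle, and this numbering of the edges identifies it with \<open>cycle5\<close>.\<close>

lemma crosses_pentagram_iff:
  "crosses pentagram {2 * i, 2 * i + 1} {2 * j, 2 * j + 1} \<longleftrightarrow> consecutive i j"
proof -
  have "{2 * i, 2 * i + 1} \<in> edges pentagram" for i
    unfolding pentagram_def by (auto simp: edges_cycle5_color)
  then have "crosses pentagram {2 * i, 2 * i + 1} {2 * j, 2 * j + 1} \<longleftrightarrow>
      {2 * i, 2 * i + 1} \<inter> {2 * j, 2 * j + 1} = {}"
    using crosses_disjoint[OF geometric_graph_pentagram] fully_crossing_pentagram
    unfolding fully_crossing_def by metis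
  moreover have "\<forall>i j :: 5. {2 * i, 2 * i + 1} \<inter> {2 * j, 2 * j + 1} = {} \<longleftrightarrow> consecutive i j"
    by (simp add: all_mod5 consecutive_def)
  ultimately show ?thesis
    by blast
qed

section \<open>Geocolorings and edge colorings\<close>

lemma verts_mono_subgraph:
  "v \<in> verts (mono_subgraph G \<epsilon> i) \<longleftrightarrow> (\<exists>e\<in>edges G. \<epsilon> e = i \<and> v \<in> e)"
  by (auto simp: mono_subgraph_def)

text \<open>Both \<open>crosses\<close> and \<open>consecutive\<close> are symmetric, so the
  unordered pairs in the two edge sets can be read as ordered ones.\<close>

lemma thickness_edge_C5_coloring_iff:
  "thickness_edge_C5_coloring G \<epsilon> \<longleftrightarrow> (\<forall>e g. crosses G e g \<longrightarrow> consecutive (\<epsilon> e) (\<epsilon> g))"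
proof -
  have "{i, j} \<in> edges cycle5 \<longleftrightarrow> consecutive i j" for i j
    by (auto simp: cycle5_def consecutive_def doubleton_eq_iff)
  moreover have "{e, g} \<in> edges (edge_crossing_graph G) \<longleftrightarrow> crosses G e g" for e g
    by (auto simp: edge_crossing_graph_def doubleton_eq_iff crosses_def Int_commute)
  moreover have "\<epsilon> ` verts (edge_crossing_graph G) \<subseteq> verts cycle5"
    by (simp add: cycle5_def)
  ultimately show ?thesis
    unfolding thickness_edge_C5_coloring_def graph_hom_def by simp
qed

definition C5_coloring_conditions :: "'a geograph \<Rightarrow> ('a set \<Rightarrow> 5) \<Rightarrow> bool" where
  "C5_coloring_conditions G \<epsilon> \<longleftrightarrow>
     thickness_edge_C5_coloring G \<epsilon> \<and>
     (\<forall>v\<in>verts G. card {i. v \<in> verts (mono_subgraph G \<epsilon> i)} \<le> 2) \<and>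
     (\<forall>i j. i \<noteq> j \<longrightarrow> verts (mono_subgraph G \<epsilon> i) \<inter> verts (mono_subgraph G \<epsilon> j) \<noteq> {} \<longrightarrow>
        \<not> consecutive i j) \<and>
     (\<forall>i. bipartite (mono_subgraph G \<epsilon> i) \<and>
        (\<exists>A B. bipartition (mono_subgraph G \<epsilon> i) A B \<and>
           verts (mono_subgraph G \<epsilon> i) \<inter> verts (mono_subgraph G \<epsilon> (i + 2)) \<subseteq> A \<and>
           verts (mono_subgraph G \<epsilon> i) \<inter> verts (mono_subgraph G \<epsilon> (i + 3)) \<subseteq> B))"

text \<open>An edge is colored by the index of its image in the pentagram. The conditions on shared
  vertices then follow from arithmetic on \<open>f v\<close>.\<close>

lemma coloring_of_geo_hom:
  assumes simple: "simple_graph G" and f: "geo_hom f G pentagram"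
  shows "\<exists>\<epsilon>. C5_coloring_conditions G \<epsilon>"
proof -
  have "\<forall>e\<in>edges G. \<exists>i. f ` e = {2 * i, 2 * i + 1}"
    using geo_hom_edge[OF f simple] by (auto simp: pentagram_def edges_cycle5_color)
  then obtain \<epsilon> where \<epsilon>: "\<And>e. e \<in> edges G \<Longrightarrow> f ` e = {2 * \<epsilon> e, 2 * \<epsilon> e + 1}"
    by metis
  let ?V = "\<lambda>i. verts (mono_subgraph G \<epsilon> i)"
  have fV: "f v = 2 * i \<or> f v = 2 * i + 1" if "v \<in> ?V i" for v i
    using that \<epsilon> by (auto simp: verts_mono_subgraph)
  \<comment> \<open>Solving for \<open>i\<close> with the inverse \<open>3\<close> of
    \<open>2\<close>; the second case is \<open>3 * (x - 1) = 3 * x + 2\<close>. Thus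
    \<open>f v\<close> leaves at most two colors at \<open>v\<close>.\<close>
  have solve: "\<forall>x i :: 5. x = 2 * i \<or> x = 2 * i + 1 \<longrightarrow> i = 3 * x \<or> i = 3 * x + 2"
    by (simp add: all_mod5)
  have V: "i = 3 * f v \<or> i = 3 * f v + 2" if "v \<in> ?V i" for v i
    using fV[OF that] solve by blast
  have thick: "thickness_edge_C5_coloring G \<epsilon>"
    unfolding thickness_edge_C5_coloring_iff
  proof (intro allI impI)
    fix e g
    assume eg: "crosses G e g"
    then have "crosses pentagram (f ` e) (f ` g)"
      by (rule geo_hom_crosses[OF f simple])
    then show "consecutive (\<epsilon> e) (\<epsilon> g)"
      using eg \<epsilon> by (simp add: crosses_def[of G] crosses_pentagram_iff)
  qed
  have two: "card {i. v \<in> ?V i} \<le> 2" for v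
  proof -
    have "{i. v \<in> ?V i} \<subseteq> {3 * f v, 3 * f v + 2}"
      using V by blast
    then have "card {i. v \<in> ?V i} \<le> card {3 * f v, 3 * f v + 2}"
      by (intro card_mono) auto
    also have "\<dots> \<le> 2"
      by (simp add: card_insert_if)
    finally show ?thesis .
  qed
  have nonconsec: "\<not> consecutive i j" if "i \<noteq> j" "?V i \<inter> ?V j \<noteq> {}" for i j
  proof -
    \<comment> \<open>The two colors possible at one vertex differ by 2.\<close>
    have "\<forall>x i j :: 5. (i = 3 * x \<or> i = 3 * x + 2) \<and> (j = 3 * x \<or> j = 3 * x + 2) \<and> i \<noteq> j
        \<longrightarrow> \<not> consecutive i j"
      by (simp add: all_mod5 consecutive_def)
    then show ?thesis
      using that V by blast
  qed
  have bip: "\<exists>A B. bipartition (mono_subgraph G \<epsilon> i) A B \<and> ?V i \<inter> ?V (i + 2) \<subseteq> A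
      \<and> ?V i \<inter> ?V (i + 3) \<subseteq> B" for i
  proof (intro exI conjI)
    let ?A = "{v \<in> ?V i. f v = 2 * i}" and ?B = "{v \<in> ?V i. f v = 2 * i + 1}"
    have "\<exists>a\<in>?A. \<exists>b\<in>?B. e = {a, b}" if "e \<in> edges (mono_subgraph G \<epsilon> i)" for e
    proof -
      have e: "e \<in> edges G" "\<epsilon> e = i"
        using that by (auto simp: mono_subgraph_def)
      obtain u v where uv: "e = {u, v}"
        using simple_graph_edgeE[OF simple e(1)] by metis
      have "{f u, f v} = {2 * i, 2 * i + 1}"
        using \<epsilon>[OF e(1)] e(2) uv by simp
      moreover have "u \<in> ?V i" "v \<in> ?V i"
        using e uv by (auto simp: verts_mono_subgraph)
      ultimately show ?thesis
        using uv by (auto simp: doubleton_eq_iff)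
    qed
    then show "bipartition (mono_subgraph G \<epsilon> i) ?A ?B"
      using fV by (auto simp: bipartition_def)
    \<comment> \<open>Modulo 5, \<open>2 * (i + 2) + 1 = 2 * i\<close> and
      \<open>2 * (i + 3) = 2 * i + 1\<close> are the ends that edge \<open>i\<close> shares with
      edges \<open>i + 2\<close> and \<open>i + 3\<close>.\<close>
    have "\<forall>x i :: 5. (x = 2 * i \<or> x = 2 * i + 1) \<longrightarrow>
        (x = 2 * (i + 2) \<or> x = 2 * (i + 2) + 1 \<longrightarrow> x = 2 * i) \<and>
        (x = 2 * (i + 3) \<or> x = 2 * (i + 3) + 1 \<longrightarrow> x = 2 * i + 1)"
      by (simp add: all_mod5)
    then show "?V i \<inter> ?V (i + 2) \<subseteq> ?A" "?V i \<inter> ?V (i + 3) \<subseteq> ?B"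
      using fV by blast+
  qed
  then have "bipartite (mono_subgraph G \<epsilon> i)" for i
    unfolding bipartite_def by blast
  then have "C5_coloring_conditions G \<epsilon>"
    unfolding C5_coloring_conditions_def using thick two nonconsec bip by simp
  then show ?thesis
    by blast
qed

text \<open>Each color prescribes an image for the vertices of its subgraph; the conditions on
  shared vertices make these prescriptions agree.\<close>

lemma geo_hom_of_coloring:
  assumes simple: "simple_graph G" and no_iso: "no_isolated_vertices G"
    and \<epsilon>: "C5_coloring_conditions G \<epsilon>"
  shows "\<exists>f. geo_hom f G pentagram"
proof -
  let ?V = "\<lambda>i. verts (mono_subgraph G \<epsilon> i)"
  have "\<forall>i. \<exists>A B. bipartition (mono_subgraph G \<epsilon> i) A B \<and> ?V i \<inter> ?V (i + 2) \<subseteq> A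
      \<and> ?V i \<inter> ?V (i + 3) \<subseteq> B"
    using \<epsilon> unfolding C5_coloring_conditions_def by blast
  then obtain A B where bip: "\<And>i. bipartition (mono_subgraph G \<epsilon> i) (A i) (B i)"
    and A: "\<And>i. ?V i \<inter> ?V (i + 2) \<subseteq> A i" and B: "\<And>i. ?V i \<inter> ?V (i + 3) \<subseteq> B i"
    by metis
  have AB: "A i \<union> B i = ?V i" "A i \<inter> B i = {}" for i
    using bip by (auto simp: bipartition_def)
  define c where "c v i = (if v \<in> A i then 2 * i else 2 * i + 1)" for v i
  \<comment> \<open>Some color at \<open>v\<close> is chosen; once the values \<open>c v i\<close>
    are known to agree, any color at \<open>v\<close> computes \<open>f v\<close>.\<close>
  define f where "f v = c v (SOME i. v \<in> ?V i)" for v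
  have shift: "c v i = c v (i + 2)" if "v \<in> ?V i" "v \<in> ?V (i + 2)" for v i
  proof -
    have "v \<in> A i"
      using A that by blast
    \<comment> \<open>Since \<open>(i + 2) + 3 = i\<close>, color \<open>i + 2\<close> has
      \<open>v\<close> on its \<open>B\<close> side and prescribes \<open>2 * (i + 2) + 1\<close>,
      which equals the value \<open>2 * i\<close> prescribed by color \<open>i\<close>.\<close>
    moreover have "v \<in> B (i + 2)"
      using B[of "i + 2"] that by (auto simp: add.assoc five_mod5)
    then have "v \<notin> A (i + 2)"
      using AB(2) by blast
    ultimately show ?thesis
      by (simp add: c_def)
  qed
  have "c v i = c v j" if "v \<in> ?V i" "v \<in> ?V j" for v i j
  proof (cases "i = j")
    case False
    then have "\<not> consecutive i j"
      using \<epsilon> that unfolding C5_coloring_conditions_def by blast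
    \<comment> \<open>Distinct colors that are not consecutive differ by 2 in one of the two
      directions, so \<open>shift\<close> covers every shared vertex.\<close>
    moreover have "\<forall>i j. i = j \<or> consecutive i j \<or> j = i + 2 \<or> i = j + 2"
      by (simp add: all_mod5 consecutive_def)
    ultimately have "j = i + 2 \<or> i = j + 2"
      using False by blast
    then show ?thesis
      using shift that by metis
  qed simp
  then have f: "f v = c v i" if "v \<in> ?V i" for v i
    unfolding f_def using that by (metis someI)
  have img: "f ` e = {2 * \<epsilon> e, 2 * \<epsilon> e + 1}" if "e \<in> edges G" for e
  proof -
    have "e \<in> edges (mono_subgraph G \<epsilon> (\<epsilon> e))"
      using that by (simp add: mono_subgraph_def)
    then obtain a b where ab: "a \<in> A (\<epsilon> e)" "b \<in> B (\<epsilon> e)" "e = {a, b}"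
      using bip by (metis bipartition_def)
    have "a \<in> ?V (\<epsilon> e)" "b \<in> ?V (\<epsilon> e)" "b \<notin> A (\<epsilon> e)"
      using ab(1,2) AB[of "\<epsilon> e"] by blast+
    then have "f a = 2 * \<epsilon> e" "f b = 2 * \<epsilon> e + 1"
      using f ab(1) by (simp_all add: c_def)
    then show ?thesis
      using ab by simp
  qed
  have "geo_hom f G pentagram"
    unfolding geo_hom_def graph_hom_def
  proof (intro conjI allI impI)
    show "f ` verts G \<subseteq> verts pentagram"
      by (simp add: pentagram_def)
  next
    fix u v
    assume "{u, v} \<in> edges G"
    then have "{f u, f v} = {2 * \<epsilon> {u, v}, 2 * \<epsilon> {u, v} + 1}"
      using img by fastforce
    then show "{f u, f v} \<in> edges pentagram"
      by (auto simp: pentagram_def edges_cycle5_color)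
  next
    fix x y u v
    assume cr: "crosses G {x, y} {u, v}"
    then have "consecutive (\<epsilon> {x, y}) (\<epsilon> {u, v})"
      using \<epsilon> by (simp add: C5_coloring_conditions_def thickness_edge_C5_coloring_iff)
    then have "crosses pentagram (f ` {x, y}) (f ` {u, v})"
      using img cr by (simp add: crosses_def[of G] crosses_pentagram_iff del: image_insert)
    then show "crosses pentagram {f x, f y} {f u, f v}"
      by simp
  qed
  then show ?thesis
    by blast
qed

theorem theorem3:
  fixes G :: "'a geograph"
  assumes "geometric_graph G" and "no_isolated_vertices G"
  shows "geocolorable cycle5 G \<longleftrightarrow>
    (\<exists>\<epsilon> :: 'a set \<Rightarrow> 5.
       thickness_edge_C5_coloring G \<epsilon> \<and>
       (\<forall>v\<in>verts G. card {i. v \<in> verts (mono_subgraph G \<epsilon> i)} \<le> 2) \<and>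
       (\<forall>i j. i \<noteq> j \<longrightarrow> verts (mono_subgraph G \<epsilon> i) \<inter> verts (mono_subgraph G \<epsilon> j) \<noteq> {} \<longrightarrow>
          \<not> consecutive i j) \<and>
       (\<forall>i. bipartite (mono_subgraph G \<epsilon> i) \<and>
          (\<exists>A B. bipartition (mono_subgraph G \<epsilon> i) A B \<and>
             verts (mono_subgraph G \<epsilon> i) \<inter> verts (mono_subgraph G \<epsilon> (i + 2)) \<subseteq> A \<and>
             verts (mono_subgraph G \<epsilon> i) \<inter> verts (mono_subgraph G \<epsilon> (i + 3)) \<subseteq> B)))"
proof -
  have "simple_graph G"
    using assms(1) by (simp add: geometric_graph_def)
  then have "geocolorable cycle5 G \<longleftrightarrow> (\<exists>\<epsilon>. C5_coloring_conditions G \<epsilon>)"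
    unfolding geocolorable_cycle5_iff
    using coloring_of_geo_hom geo_hom_of_coloring assms(2) by blast
  then show ?thesis
    unfolding C5_coloring_conditions_def .
qed

end
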